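(* Let $P(x)=d_1-d_2x$ with $d_1,d_2>0$. Assume that $(P(X_0)-c)h>(r+\delta)\alpha$ and that there exists $t_0\in[0,T]$ with $$h\int_{t_0}^{T} e^{-(r+\delta)(s-t_0)}\big(P(X_0e^{-\delta s})-c\big)\,ds>\alpha .$$ Let $(X,u)$ be the unique solution on $[0,T]$ of $$\dot X_t=-\delta X_t+\frac1\beta (u_t-\alpha)^+,\qquad \dot u_t=(r+\delta)u_t-\big(P(X_t)-c\big)h,$$ with given $X_0\ge 0$ and $u_T=0$, and let $T^\star\in(0,T)$ be such that $u_t\ge\alpha$ for $t\le T^\star$ and $u_t\le\alpha$ for $t\ge T^\star$. Then $$X_t=\begin{cases} C e^{r_1t}+De^{r_2t}+\theta, & t\in[0,T^\star],\\ X_{T^\star}e^{-\delta(t-T^\star)}, & t\in[T^\star,T],\end{cases}$$ where $$\theta=\frac{h(d_1-c)-(r+\delta)\alpha}{\beta(r+\delta)\delta+hd_2},\qquad C=\frac{(X_0-\theta)(r_2+\delta)+\delta\theta e^{-r_2T^\star}}{(r_2+\delta)-e^{(r_1-r_2)T^\star}(r_1+\delta)},\qquad D=X_0-C-\theta,$$ $$r_{1}=\frac12\Big(r+\sqrt{r^2+4\big((r+\delta)\delta+\tfrac{h}{\beta}d_2\big)}\Big),\qquad r_{2}=\frac12\Big(r-\sqrt{r^2+4\big((r+\delta)\delta+\tfrac{h}{\beta}d_2\big)}\Big),$$ and $T^\star$ is a solution of the transcendental equation $$\alpha=\frac{h(d_1-c)}{r+\delta}\big(1-e^{-(r+\delt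a)(T-T^\star)}\big)-\frac{hd_2}{r+2\delta}\big(1-e^{-(r+2\delta)(T-T^\star)}\big)\big(Ce^{r_1T^\star}+De^{r_2T^\star}+\theta\big).$$
   Context: Constants: $T>0$, $\delta>0$, $r>0$, $\alpha>0$, $\beta>0$, $c>0$, $h\in[0,8760]$, and a given initial value $X_0\ge 0$. Notation: $y^+=\max(y,0)$. A solution of the forward-backward system is a pair of continuously differentiable functions $X:[0,T]\to[0,\infty)$, $u:[0,T]\to\mathbb{R}$ satisfying both equations and the boundary conditions. Under the stated hypotheses such a solution exists and is unique, and a time $T^\star$ with the stated property exists. *)

theory Defs
  imports "HOL-Analysis.Analysis"
begin

text \<open>
  The library predicate \<open>C1_differentiable_on\<close> asks for two-sided derivatives at every point of
  the set.  The functions considered here live on the closed interval \<open>[0,T]\<close> only, so that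
  derivatives are taken within the set, i.e. one-sided at the endpoints.
\<close>

definition continuously_differentiable_within :: "(real \<Rightarrow> real) \<Rightarrow> real set \<Rightarrow> bool" where
  "continuously_differentiable_within f S \<longleftrightarrow>
     (\<exists>f'. (\<forall>t\<in>S. (f has_real_derivative f' t) (at t within S)) \<and> continuous_on S f')"

text \<open>
  The functions \<open>X\<close> and \<open>u\<close> are total in HOL; their values outside \<open>[0,T]\<close> are irrelevant.
\<close>

definition forward_backward_solution ::
  "real \<Rightarrow> real \<Rightarrow> real \<Rightarrow> real \<Rightarrow> real \<Rightarrow> real \<Rightarrow> real \<Rightarrow> (real \<Rightarrow> real) \<Rightarrow> real \<Rightarrow>
   (real \<Rightarrow> real) \<Rightarrow> (real \<Rightarrow> real) \<Rightarrow> bool" where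
  "forward_backward_solution T \<delta> r \<alpha> \<beta> c h P X\<^sub>0 X u \<longleftrightarrow>
     continuously_differentiable_within X {0..T} \<and>
     continuously_differentiable_within u {0..T} \<and>
     (\<forall>t\<in>{0..T}. X t \<ge> 0) \<and>
     (\<forall>t\<in>{0..T}. (X has_real_derivative (- \<delta> * X t + 1 / \<beta> * max (u t - \<alpha>) 0))
                    (at t within {0..T})) \<and>
     (\<forall>t\<in>{0..T}. (u has_real_derivative ((r + \<delta>) * u t - (P (X t) - c) * h))
                    (at t within {0..T})) \<and>
     X 0 = X\<^sub>0 \<and> u T = 0"

end

theory Submission
  imports Defs
begin

text \<open>
  The time \<open>T'\<close> separates two regimes in which the positive part disappears, so that the system
  becomes linear with constant coefficients.

  On \<open>[0,T']\<close> the positive part is \<open>u - \<alpha>\<close>, and the system is an affine planar one with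
  equilibrium \<open>(\<theta>, \<alpha> + \<beta> * \<delta> * \<theta>)\<close>.  Its matrix has the distinct eigenvalues \<open>r\<^sub>1\<close> and \<open>r\<^sub>2\<close>,
  so \<open>X - \<theta>\<close> is a combination of \<open>exp (r\<^sub>1 * t)\<close> and \<open>exp (r\<^sub>2 * t)\<close>
  (\<open>planar_linear_system_solution\<close>).  The two coefficients are determined by the two boundary
  values that are known: \<open>X 0 = X\<^sub>0\<close>, and \<open>u T' = \<alpha>\<close>, which holds because both sign conditions
  on \<open>u - \<alpha>\<close> apply at \<open>T'\<close>.  Solving these two linear equations gives \<open>C\<close> and \<open>D\<close>
  (\<open>two_exponentials_coefficient\<close>).

  On \<open>[T',T]\<close> the positive part is \<open>0\<close>, so \<open>X\<close> decays exponentially, and \<open>u\<close> solves a scalar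
  linear equation whose forcing is a constant plus an exponential.  Expressing the value
  \<open>u T' = \<alpha>\<close> through the terminal value \<open>u T = 0\<close>
  (\<open>linear_ode_initial_value_from_terminal_value\<close>), and inserting the value of \<open>X T'\<close> found on the
  first interval, gives the transcendental equation.
\<close>

lemma exponential_ode_unique:
  fixes f :: "real \<Rightarrow> real"
  assumes deriv: "\<And>t. t \<in> {a..b} \<Longrightarrow> (f has_real_derivative k * f t) (at t within {a..b})"
    and t: "t \<in> {a..b}"
  shows "f t = f a * exp (k * (t - a))"
proof -
  define g where "g s = f s * exp (- k * (s - a))" for s
  have "(g has_real_derivative 0) (at s within {a..b})" if "s \<in> {a..b}" for s
    unfolding g_def
    by (rule derivative_eq_intros deriv[OF that] refl | simp add: algebra_simps)+
  then have "\<exists>c. \<forall>s\<in>{a..b}. g s = c"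
    by (intro has_field_derivative_zero_constant) auto
  then have "g t = g a"
    using t by force
  then have "f t * exp (- k * (t - a)) * exp (k * (t - a)) = f a * exp (k * (t - a))"
    by (simp add: g_def)
  then show ?thesis
    by (simp add: mult.assoc flip: exp_add)
qed

text \<open>
  The hypotheses on \<open>r\<^sub>1\<close> and \<open>r\<^sub>2\<close> say that they are the eigenvalues of the coefficient matrix.
  The left eigenvectors are \<open>(a - r\<^sub>2, b)\<close> and \<open>(a - r\<^sub>1, b)\<close>; the corresponding combinations of
  \<open>x\<close> and \<open>y\<close> solve scalar equations, and \<open>x\<close> and \<open>b * y\<close> are recovered from them because the
  eigenvalues are distinct.  The second formula is the first equation of the system solved for
  \<open>b * y\<close>; keeping the factor \<open>b\<close> covers the case \<open>b = 0\<close>.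
\<close>

lemma planar_linear_system_solution:
  fixes x y :: "real \<Rightarrow> real"
  assumes x: "\<And>t. t \<in> {0..\<tau>} \<Longrightarrow> (x has_real_derivative a * x t + b * y t) (at t within {0..\<tau>})"
    and y: "\<And>t. t \<in> {0..\<tau>} \<Longrightarrow> (y has_real_derivative p * x t + q * y t) (at t within {0..\<tau>})"
    and trace: "r\<^sub>1 + r\<^sub>2 = a + q"
    and det: "r\<^sub>1 * r\<^sub>2 = a * q - b * p"
    and distinct: "r\<^sub>1 \<noteq> r\<^sub>2"
  shows "\<exists>A B. \<forall>t\<in>{0..\<tau>}.
           x t = A * exp (r\<^sub>1 * t) + B * exp (r\<^sub>2 * t) \<and>
           b * y t = (r\<^sub>1 - a) * A * exp (r\<^sub>1 * t) + (r\<^sub>2 - a) * B * exp (r\<^sub>2 * t)"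
proof -
  \<comment> \<open>Here \<open>k\<close> is one eigenvalue and \<open>s\<close> the other; \<open>w\<close> is the left eigenvector combination for \<open>k\<close>.\<close>
  have decoupled: "b * y t - (s - a) * x t = (b * y 0 - (s - a) * x 0) * exp (k * t)"
    if trace': "k + s = a + q" and det': "k * s = a * q - b * p" and t: "t \<in> {0..\<tau>}" for k s t
  proof -
    define w where "w t = b * y t - (s - a) * x t" for t
    have "(w has_real_derivative k * w t) (at t within {0..\<tau>})" if t: "t \<in> {0..\<tau>}" for t
    proof -
      have k: "k = a + q - s"
        using trace' by simp
      have bp: "b * p = a * q - (a + q - s) * s"
        using det' unfolding k by simp
      have "b * (p * x t + q * y t) - (s - a) * (a * x t + b * y t)
          = (b * p) * x t + b * q * y t - (s - a) * (a * x t + b * y t)"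
        by (simp add: algebra_simps)
      also have "\<dots> = k * w t"
        unfolding bp w_def k by (simp add: algebra_simps)
      finally have "b * (p * x t + q * y t) - (s - a) * (a * x t + b * y t) = k * w t" .
      moreover have "(w has_real_derivative b * (p * x t + q * y t) - (s - a) * (a * x t + b * y t))
          (at t within {0..\<tau>})"
        unfolding w_def by (intro DERIV_diff DERIV_cmult x y t)
      ultimately show ?thesis
        by simp
    qed
    then have "w t = w 0 * exp (k * (t - 0))"
      by (rule exponential_ode_unique[OF _ t])
    then show ?thesis
      by (simp add: w_def)
  qed
  define w\<^sub>1 where "w\<^sub>1 = b * y 0 - (r\<^sub>2 - a) * x 0"
  define w\<^sub>2 where "w\<^sub>2 = b * y 0 - (r\<^sub>1 - a) * x 0"
  have w1: "b * y t - (r\<^sub>2 - a) * x t = w\<^sub>1 * exp (r\<^sub>1 * t)" if "t \<in> {0..\<tau>}" for t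
    unfolding w\<^sub>1_def using decoupled[OF trace det that] .
  have w2: "b * y t - (r\<^sub>1 - a) * x t = w\<^sub>2 * exp (r\<^sub>2 * t)" if "t \<in> {0..\<tau>}" for t
    unfolding w\<^sub>2_def using decoupled[of r\<^sub>2 r\<^sub>1, OF _ _ that] trace det by (simp add: mult.commute)
  define A where "A = w\<^sub>1 / (r\<^sub>1 - r\<^sub>2)"
  define B where "B = - w\<^sub>2 / (r\<^sub>1 - r\<^sub>2)"
  have A: "w\<^sub>1 = (r\<^sub>1 - r\<^sub>2) * A" and B: "w\<^sub>2 = - ((r\<^sub>1 - r\<^sub>2) * B)"
    using distinct by (simp_all add: A_def B_def)
  have x_eq: "x t = A * exp (r\<^sub>1 * t) + B * exp (r\<^sub>2 * t)" if "t \<in> {0..\<tau>}" for t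
  proof -
    have "(r\<^sub>1 - r\<^sub>2) * x t = (r\<^sub>1 - r\<^sub>2) * (A * exp (r\<^sub>1 * t) + B * exp (r\<^sub>2 * t))"
      using w1[OF that] w2[OF that] unfolding A B by (simp add: algebra_simps)
    then show ?thesis
      using distinct by simp
  qed
  moreover have "b * y t = (r\<^sub>1 - a) * A * exp (r\<^sub>1 * t) + (r\<^sub>2 - a) * B * exp (r\<^sub>2 * t)"
    if "t \<in> {0..\<tau>}" for t
    using w1[OF that] unfolding A x_eq[OF that] by (simp add: algebra_simps)
  ultimately show ?thesis
    by blast
qed

text \<open>
  Eliminating \<open>B\<close> and dividing by \<open>exp (r\<^sub>2 * \<tau>)\<close> leaves one linear equation for \<open>A\<close>, whose
  coefficient is nonzero because \<open>r\<^sub>2 \<le> - \<delta> < r\<^sub>1\<close>.  For \<open>x t = A * exp (r\<^sub>1 * t) + B * exp (r\<^sub>2 * t)\<close>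
  the two conditions are \<open>x 0 = y\<close> and \<open>x' \<tau> + \<delta> * x \<tau> = - m\<close>; the second one is the form that
  \<open>u T' = \<alpha>\<close> takes in terms of \<open>x = X - \<theta>\<close>, with \<open>m = \<delta> * \<theta>\<close>.
\<close>

lemma two_exponentials_coefficient:
  fixes A B :: real
  assumes initial: "A + B = y"
    and final: "(r\<^sub>1 + \<delta>) * A * exp (r\<^sub>1 * \<tau>) + (r\<^sub>2 + \<delta>) * B * exp (r\<^sub>2 * \<tau>) = - m"
    and r1: "r\<^sub>1 + \<delta> > 0" and r2: "r\<^sub>2 + \<delta> \<le> 0"
  shows "A = (y * (r\<^sub>2 + \<delta>) + m * exp (- r\<^sub>2 * \<tau>))
               / ((r\<^sub>2 + \<delta>) - exp ((r\<^sub>1 - r\<^sub>2) * \<tau>) * (r\<^sub>1 + \<delta>))"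
proof -
  have "exp ((r\<^sub>1 - r\<^sub>2) * \<tau>) * (r\<^sub>1 + \<delta>) > 0"
    using r1 by simp
  then have nonzero: "(r\<^sub>2 + \<delta>) - exp ((r\<^sub>1 - r\<^sub>2) * \<tau>) * (r\<^sub>1 + \<delta>) \<noteq> 0"
    using r2 by linarith
  have e1: "exp (r\<^sub>1 * \<tau>) * exp (- r\<^sub>2 * \<tau>) = exp ((r\<^sub>1 - r\<^sub>2) * \<tau>)"
    by (simp add: algebra_simps flip: exp_add)
  have e2: "exp (r\<^sub>2 * \<tau>) * exp (- r\<^sub>2 * \<tau>) = 1"
    by (simp flip: exp_add)
  have "- m * exp (- r\<^sub>2 * \<tau>)
      = (r\<^sub>1 + \<delta>) * A * (exp (r\<^sub>1 * \<tau>) * exp (- r\<^sub>2 * \<tau>))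
        + (r\<^sub>2 + \<delta>) * B * (exp (r\<^sub>2 * \<tau>) * exp (- r\<^sub>2 * \<tau>))"
    unfolding final[symmetric] by (simp only: ring_distribs mult.assoc)
  also have "\<dots> = (r\<^sub>1 + \<delta>) * A * exp ((r\<^sub>1 - r\<^sub>2) * \<tau>) + (r\<^sub>2 + \<delta>) * (y - A)"
    unfolding e1 e2 initial[symmetric] by simp
  finally have "A * ((r\<^sub>2 + \<delta>) - exp ((r\<^sub>1 - r\<^sub>2) * \<tau>) * (r\<^sub>1 + \<delta>))
      = y * (r\<^sub>2 + \<delta>) + m * exp (- r\<^sub>2 * \<tau>)"
    by (simp add: algebra_simps)
  with nonzero show ?thesis
    by (simp add: eq_divide_eq)
qed

text \<open>
  The function \<open>p / k - q / (k + \<delta>) * exp (- \<delta> * (t - a))\<close> is a particular solution; the difference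
  of \<open>y\<close> and it is a multiple of \<open>exp (k * t)\<close>, so its value at \<open>a\<close> is determined by its value at \<open>b\<close>.
\<close>

lemma linear_ode_initial_value_from_terminal_value:
  fixes y :: "real \<Rightarrow> real"
  assumes deriv: "\<And>t. t \<in> {a..b} \<Longrightarrow>
      (y has_real_derivative k * y t - p + q * exp (- \<delta> * (t - a))) (at t within {a..b})"
    and ab: "a \<le> b" and k: "k \<noteq> 0" and k\<delta>: "k + \<delta> \<noteq> 0"
  shows "y a = y b * exp (- k * (b - a)) + p / k * (1 - exp (- k * (b - a)))
           - q / (k + \<delta>) * (1 - exp (- (k + \<delta>) * (b - a)))"
proof -
  define P where "P = p / k"
  define Q where "Q = q / (k + \<delta>)"
  have p: "p = k * P"
    using k by (simp add: P_def)
  have "q = (k + \<delta>) * Q"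
    using k\<delta> by (simp add: Q_def)
  then have q: "q = k * Q + \<delta> * Q"
    by (simp only: distrib_right)
  define z where "z t = y t - P + Q * exp (- \<delta> * (t - a))" for t
  have "(z has_real_derivative k * z t) (at t within {a..b})" if "t \<in> {a..b}" for t
    unfolding z_def
    by (rule derivative_eq_intros deriv[OF that] refl | simp add: p q algebra_simps)+
  then have "z b = z a * exp (k * (b - a))"
    by (rule exponential_ode_unique) (use ab in auto)
  then have "z a = z b * exp (- k * (b - a))"
    by (simp add: mult.assoc flip: exp_add)
  then have "y a = y b * exp (- k * (b - a)) + P * (1 - exp (- k * (b - a)))
      - Q * (1 - exp (- \<delta> * (b - a)) * exp (- k * (b - a)))"
    unfolding z_def by (simp add: algebra_simps)
  also have "exp (- \<delta> * (b - a)) * exp (- k * (b - a)) = exp (- (k + \<delta>) * (b - a))"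
    by (simp add: algebra_simps flip: exp_add)
  finally show ?thesis
    unfolding P_def Q_def .
qed

text \<open>
  These are the roots of \<open>(\<lambda> + \<delta>) * (\<lambda> - (r + \<delta>)) = m\<close>.  The left-hand side is \<open>0 \<le> m\<close> at
  \<open>\<lambda> = - \<delta>\<close>, so \<open>- \<delta>\<close> lies between the roots, possibly at the smaller one.
\<close>

lemma characteristic_roots:
  fixes r \<delta> m r\<^sub>1 r\<^sub>2 :: real
  assumes r: "r > 0" and \<delta>: "\<delta> > 0" and m: "m \<ge> 0"
    and r1: "r\<^sub>1 = 1 / 2 * (r + sqrt (r\<^sup>2 + 4 * ((r + \<delta>) * \<delta> + m)))"
    and r2: "r\<^sub>2 = 1 / 2 * (r - sqrt (r\<^sup>2 + 4 * ((r + \<delta>) * \<delta> + m)))"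
  shows "r\<^sub>1 + r\<^sub>2 = r" "r\<^sub>1 * r\<^sub>2 = - ((r + \<delta>) * \<delta> + m)" "r\<^sub>1 > 0" "r\<^sub>2 + \<delta> \<le> 0"
proof -
  define R where "R = sqrt (r\<^sup>2 + 4 * ((r + \<delta>) * \<delta> + m))"
  have R2: "R\<^sup>2 = r\<^sup>2 + 4 * ((r + \<delta>) * \<delta> + m)"
    using r \<delta> m unfolding R_def by (intro real_sqrt_pow2) simp
  have "(r + 2 * \<delta>)\<^sup>2 \<le> r\<^sup>2 + 4 * ((r + \<delta>) * \<delta> + m)"
    using m by (simp add: power2_eq_square algebra_simps)
  then have "r + 2 * \<delta> \<le> R"
    unfolding R_def by (rule real_le_rsqrt)
  then show "r\<^sub>1 > 0" "r\<^sub>2 + \<delta> \<le> 0"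
    using r \<delta> unfolding r1 r2 R_def[symmetric] by (simp_all add: field_simps)
  show "r\<^sub>1 + r\<^sub>2 = r"
    unfolding r1 r2 by (simp add: field_simps)
  have "r\<^sub>1 * r\<^sub>2 = (r\<^sup>2 - R\<^sup>2) / 4"
    unfolding r1 r2 R_def[symmetric] by (simp add: power2_eq_square algebra_simps)
  then show "r\<^sub>1 * r\<^sub>2 = - ((r + \<delta>) * \<delta> + m)"
    unfolding R2 by simp
qed

theorem proposition3p2:
  fixes T \<delta> r \<alpha> \<beta> c h X\<^sub>0 d\<^sub>1 d\<^sub>2 T' :: real
    and P X u :: "real \<Rightarrow> real"
    and \<theta> C D r\<^sub>1 r\<^sub>2 :: real
  assumes "T > 0" and "\<delta> > 0" and "r > 0" and "\<alpha> > 0" and "\<beta> > 0" and "c > 0"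
    and "h \<in> {0..8760}" and "X\<^sub>0 \<ge> 0"
    and "d\<^sub>1 > 0" and "d\<^sub>2 > 0" and "\<And>x. P x = d\<^sub>1 - d\<^sub>2 * x"
    and "(P X\<^sub>0 - c) * h > (r + \<delta>) * \<alpha>"
    and "\<exists>t\<^sub>0\<in>{0..T}.
           h * integral {t\<^sub>0..T} (\<lambda>s. exp (- (r + \<delta>) * (s - t\<^sub>0)) * (P (X\<^sub>0 * exp (- \<delta> * s)) - c)) > \<alpha>"
    and "forward_backward_solution T \<delta> r \<alpha> \<beta> c h P X\<^sub>0 X u"
    and "T' \<in> {0<..<T}"
    and "\<forall>t\<in>{0..T'}. u t \<ge> \<alpha>"
    and "\<forall>t\<in>{T'..T}. u t \<le> \<alpha>"
    and "r\<^sub>1 = 1 / 2 * (r + sqrt (r\<^sup>2 + 4 * ((r + \<delta>) * \<delta> + h / \<beta> * d\<^sub>2)))"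
    and "r\<^sub>2 = 1 / 2 * (r - sqrt (r\<^sup>2 + 4 * ((r + \<delta>) * \<delta> + h / \<beta> * d\<^sub>2)))"
    and "\<theta> = (h * (d\<^sub>1 - c) - (r + \<delta>) * \<alpha>) / (\<beta> * (r + \<delta>) * \<delta> + h * d\<^sub>2)"
    and "C = ((X\<^sub>0 - \<theta>) * (r\<^sub>2 + \<delta>) + \<delta> * \<theta> * exp (- r\<^sub>2 * T'))
               / ((r\<^sub>2 + \<delta>) - exp ((r\<^sub>1 - r\<^sub>2) * T') * (r\<^sub>1 + \<delta>))"
    and "D = X\<^sub>0 - C - \<theta>"
  shows "(\<forall>t\<in>{0..T'}. X t = C * exp (r\<^sub>1 * t) + D * exp (r\<^sub>2 * t) + \<theta>) \<and>
         (\<forall>t\<in>{T'..T}. X t = X T' * exp (- \<delta> * (t - T'))) \<and>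
         \<alpha> = h * (d\<^sub>1 - c) / (r + \<delta>) * (1 - exp (- (r + \<delta>) * (T - T')))
             - h * d\<^sub>2 / (r + 2 * \<delta>) * (1 - exp (- (r + 2 * \<delta>) * (T - T')))
               * (C * exp (r\<^sub>1 * T') + D * exp (r\<^sub>2 * T') + \<theta>)"
proof -
  define m where "m = h * d\<^sub>2"
  have pos: "T > 0" "\<delta> > 0" "r > 0" "\<beta> > 0" "m \<ge> 0" and T': "0 < T'" "T' < T"
    using assms by (auto simp: m_def)
  have X': "(X has_real_derivative - \<delta> * X t + 1 / \<beta> * max (u t - \<alpha>) 0) (at t within {0..T})"
    and u': "(u has_real_derivative (r + \<delta>) * u t - (P (X t) - c) * h) (at t within {0..T})"
    if "t \<in> {0..T}" for t
    using assms(14) that unfolding forward_backward_solution_def by blast+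
  have X0: "X 0 = X\<^sub>0" and uT: "u T = 0"
    using assms(14) unfolding forward_backward_solution_def by blast+
  have uT': "u T' = \<alpha>"
    using assms(16,17) T' by (intro antisym) auto
  have "h / \<beta> * d\<^sub>2 = m / \<beta>" and "m / \<beta> \<ge> 0"
    using pos by (simp_all add: m_def)
  with pos assms(18,19)
  have roots: "r\<^sub>1 + r\<^sub>2 = r" "r\<^sub>1 * r\<^sub>2 = - ((r + \<delta>) * \<delta> + m / \<beta>)" "r\<^sub>1 > 0" "r\<^sub>2 + \<delta> \<le> 0"
    using characteristic_roots[of r \<delta> "m / \<beta>" r\<^sub>1 r\<^sub>2] by metis+

  \<comment> \<open>Measuring \<open>X\<close> and \<open>u\<close> from the equilibrium \<open>(\<theta>, \<alpha> + \<beta> * \<delta> * \<theta>)\<close> makes the system homogeneous.\<close>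
  have "\<beta> * (r + \<delta>) * \<delta> + m > 0"
    using pos by (intro add_pos_nonneg) auto
  then have "\<theta> * (\<beta> * (r + \<delta>) * \<delta> + m) = h * (d\<^sub>1 - c) - (r + \<delta>) * \<alpha>"
    using assms(20) by (simp add: m_def)
  then have equilibrium: "(r + \<delta>) * (\<alpha> + \<beta> * \<delta> * \<theta>) = h * (d\<^sub>1 - c) - m * \<theta>"
    by (simp add: algebra_simps)
  define x where "x t = X t - \<theta>" for t
  define y where "y t = u t - (\<alpha> + \<beta> * \<delta> * \<theta>)" for t
  have "(x has_real_derivative - \<delta> * x t + 1 / \<beta> * y t) (at t within {0..T'})"
    if t: "t \<in> {0..T'}" for t
  proof -
    have "u t \<ge> \<alpha>"
      using assms(16) t by blast
    then have "- \<delta> * X t + 1 / \<beta> * max (u t - \<alpha>) 0 = - \<delta> * x t + 1 / \<beta> * y t"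
      using pos by (simp add: x_def y_def field_simps)
    moreover have "(X has_real_derivative - \<delta> * X t + 1 / \<beta> * max (u t - \<alpha>) 0) (at t within {0..T'})"
      using X'[of t] t T' by (auto intro: DERIV_subset)
    ultimately show ?thesis
      unfolding x_def by (auto intro!: derivative_eq_intros)
  qed
  moreover have "(y has_real_derivative m * x t + (r + \<delta>) * y t) (at t within {0..T'})"
    if t: "t \<in> {0..T'}" for t
  proof -
    have "(r + \<delta>) * u t - (P (X t) - c) * h
        = (r + \<delta>) * u t - (h * (d\<^sub>1 - c) - m * \<theta>) + m * x t"
      by (simp add: assms(11) m_def x_def algebra_simps)
    also have "\<dots> = m * x t + (r + \<delta>) * y t"
      unfolding equilibrium[symmetric] y_def by (simp add: algebra_simps)
    finally have "(r + \<delta>) * u t - (P (X t) - c) * h = m * x t + (r + \<delta>) * y t" .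
    moreover have "(u has_real_derivative (r + \<delta>) * u t - (P (X t) - c) * h) (at t within {0..T'})"
      using u'[of t] t T' by (auto intro: DERIV_subset)
    ultimately show ?thesis
      unfolding y_def by (auto intro!: derivative_eq_intros)
  qed
  moreover have "r\<^sub>1 + r\<^sub>2 = - \<delta> + (r + \<delta>)" "r\<^sub>1 * r\<^sub>2 = - \<delta> * (r + \<delta>) - 1 / \<beta> * m" "r\<^sub>1 \<noteq> r\<^sub>2"
    using roots pos by (auto simp: algebra_simps)
  ultimately have "\<exists>A B. \<forall>t\<in>{0..T'}.
      x t = A * exp (r\<^sub>1 * t) + B * exp (r\<^sub>2 * t) \<and>
      1 / \<beta> * y t = (r\<^sub>1 - - \<delta>) * A * exp (r\<^sub>1 * t) + (r\<^sub>2 - - \<delta>) * B * exp (r\<^sub>2 * t)"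
    by (rule planar_linear_system_solution)
  then obtain A B where
    x: "\<And>t. t \<in> {0..T'} \<Longrightarrow> x t = A * exp (r\<^sub>1 * t) + B * exp (r\<^sub>2 * t)" and
    y: "\<And>t. t \<in> {0..T'} \<Longrightarrow>
      1 / \<beta> * y t = (r\<^sub>1 - - \<delta>) * A * exp (r\<^sub>1 * t) + (r\<^sub>2 - - \<delta>) * B * exp (r\<^sub>2 * t)"
    by blast
  have initial: "A + B = X\<^sub>0 - \<theta>"
    using x[of 0] T' X0 by (simp add: x_def)
  have "(r\<^sub>1 + \<delta>) * A * exp (r\<^sub>1 * T') + (r\<^sub>2 + \<delta>) * B * exp (r\<^sub>2 * T') = - (\<delta> * \<theta>)"
    using y[of T'] T' pos by (simp add: y_def uT')
  then have "A = C"
    using two_exponentials_coefficient[OF initial] roots pos unfolding assms(21) by simp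
  moreover from this have "B = D"
    using initial assms(22) by simp
  ultimately have X_before: "X t = C * exp (r\<^sub>1 * t) + D * exp (r\<^sub>2 * t) + \<theta>"
    if "t \<in> {0..T'}" for t
    using x[OF that] by (simp add: x_def)

  have "(X has_real_derivative - \<delta> * X t) (at t within {T'..T})" if t: "t \<in> {T'..T}" for t
  proof -
    have "max (u t - \<alpha>) 0 = 0"
      using assms(17) t by simp
    then have "(X has_real_derivative - \<delta> * X t) (at t within {0..T})"
      using X'[of t] t T' by simp
    then show ?thesis
      by (rule DERIV_subset) (use T' in auto)
  qed
  then have X_after: "X t = X T' * exp (- \<delta> * (t - T'))" if "t \<in> {T'..T}" for t
    by (rule exponential_ode_unique[OF _ that])
  have "(u has_real_derivative (r + \<delta>) * u t - h * (d\<^sub>1 - c)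
      + h * d\<^sub>2 * X T' * exp (- \<delta> * (t - T'))) (at t within {T'..T})"
    if t: "t \<in> {T'..T}" for t
  proof -
    have "(r + \<delta>) * u t - (P (X t) - c) * h = (r + \<delta>) * u t - h * (d\<^sub>1 - c)
        + h * d\<^sub>2 * X T' * exp (- \<delta> * (t - T'))"
      unfolding assms(11) X_after[OF t] by (simp add: algebra_simps)
    moreover have "(u has_real_derivative (r + \<delta>) * u t - (P (X t) - c) * h) (at t within {T'..T})"
      using u'[of t] t T' by (auto intro: DERIV_subset)
    ultimately show ?thesis
      by (simp only:)
  qed
  then have "u T' = u T * exp (- (r + \<delta>) * (T - T'))
      + h * (d\<^sub>1 - c) / (r + \<delta>) * (1 - exp (- (r + \<delta>) * (T - T')))
      - h * d\<^sub>2 * X T' / (r + \<delta> + \<delta>) * (1 - exp (- (r + \<delta> + \<delta>) * (T - T')))"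
    by (rule linear_ode_initial_value_from_terminal_value) (use pos T' in auto)
  moreover have "r + \<delta> + \<delta> = r + 2 * \<delta>"
    by simp
  ultimately have "\<alpha> = h * (d\<^sub>1 - c) / (r + \<delta>) * (1 - exp (- (r + \<delta>) * (T - T')))
      - h * d\<^sub>2 / (r + 2 * \<delta>) * (1 - exp (- (r + 2 * \<delta>) * (T - T'))) * X T'"
    unfolding uT uT' by (simp only: mult_zero_left add_0_left mult_ac times_divide_eq_left times_divide_eq_right)
  moreover have "X T' = C * exp (r\<^sub>1 * T') + D * exp (r\<^sub>2 * T') + \<theta>"
    using X_before[of T'] T' by simp
  ultimately show ?thesis
    using X_before X_after by (simp only:) blast
qed

end
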